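(* Let $\mu,\nu,\alpha,\beta\in\mathbb R$ with $\beta\ge0$ and $\alpha>-\beta$, and let $\mathbf h^{\alpha\beta}_{\mu\nu}$ be the left-invariant metric on the sub-bundle $\mathcal E$ of $T\mathcal G_{\mu\nu}$ which is the restriction of the left translation of the inner product $\langle\cdot,\cdot\rangle^{\alpha\beta}_{\mu\nu}$ on $\mathfrak g_{\mu\nu}$. If $(\gamma,b)\colon I\to\mathcal G_{\mu\nu}$ is a normal sub-Riemannian geodesic for $\mathbf h^{\alpha\beta}_{\mu\nu}$, then its left logarithmic derivative is of the form $(u,0)$ with $u\in\mathrm{Vect}_0S^1$, and there are constants $\lambda_1,\lambda_2\in\mathbb R$ such that $$L_{\alpha\beta}\dot u=u\,L_{\alpha\beta}u'+2u'\,L_{\alpha\beta}u-2\lambda_1u'-\lambda_2L_{\mu\nu}u'.$$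
   Context: $I=[0,1]$; $'=\partial_\theta$, $\dot{}=\partial_t$; curves are smooth. $\widetilde{\mathrm{Diff}}\,S^1$ is the group of smooth orientation preserving diffeomorphisms $\phi$ of $\mathbb R$ with $\phi(\theta+2\pi)=\phi(\theta)+2\pi$, with Lie algebra $\mathrm{Vect}\,S^1\cong C^\infty(S^1)$ ($x\,\partial_\theta$ is identified with $x$), bracket $[x,y]=x'y-y'x$. $\mathcal G_{\mu\nu}$ is the Lie group $\widetilde{\mathrm{Diff}}\,S^1\times\mathbb R$ with multiplication $$(\phi_1,b_1)(\phi_2,b_2)=\big(\phi_1\circ\phi_2,\ b_1+b_2+\mu A(\phi_1,\phi_2)+\nu B(\phi_1,\phi_2)\big),$$ $$A(\phi_1,\phi_2)=\frac1{4\pi}\int_0^{2\pi}(-\phi_1\circ\phi_2+\phi_1+\phi_2-\mathrm{id})\,d\theta,\qquad B(\phi_1,\phi_2)=\frac1{4\pi}\int_0^{2\pi}\log(\phi_1\circ\phi_2)'\,d\log\phi_2',$$ and Lie algebra $\mathfrak g_{\mu\nu}=\mathrm{Vect}\,S^1\oplus\mathbb R$, $[(x,a_1),(y,a_2)]=([x,y],\omega_{\mu\nu}(x,y))$, $\omega_{\mu\nu}(x,y)=\frac1{2\pi}\int_0^{2\pi}(\mu xy'+\nu x'y'')\,d\theta$. $\eta(x)=\frac1{2\pi}\int_0^{2\pi}x\,d\theta$, $\mathrm{Vect}_0S^1=\ker\eta$. $\mathcal E$ is obtained by left translations of $(\mathrm{Vect}_0S^1,0)$, and $\widehat{\mathfrak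 k}=\{(a_0\partial_\theta,a):a_0,a\in\mathbb R\}$, so $\mathfrak g_{\mu\nu}=\mathrm{Vect}_0S^1\oplus\widehat{\mathfrak k}$. $L_{\alpha\beta}x=\beta x''-\alpha x$ and similarly $L_{\mu\nu}x=\nu x''-\mu x$. The inner products are $\langle x,y\rangle^{\alpha\beta}=\frac1{2\pi}\int_0^{2\pi}\big(\alpha(x-\eta(x))(y-\eta(y))+\beta x'y'\big)d\theta+\eta(x)\eta(y)$ on $\mathrm{Vect}\,S^1$ and $\langle(x,a_1),(y,a_2)\rangle^{\alpha\beta}_{\mu\nu}=\langle x,y\rangle^{\alpha\beta}+a_1a_2$ on $\mathfrak g_{\mu\nu}$; $\mathrm{ad}^\top$ denotes the adjoint of $\mathrm{ad}$ on $\mathfrak g_{\mu\nu}$ with respect to the latter. The left logarithmic derivative of a curve $c$ is $U(t)=d\ell_{c(t)^{-1}}\dot c(t)$; for $c=(\gamma,b)$ its first component is $u=\dot\gamma/\gamma'$. A normal sub-Riemannian geodesic is an $\mathcal E$-horizontal critical curve of $\frac12\int_0^1\mathbf h^{\alpha\beta}_{\mu\nu}(\dot c,\dot c)dt$ with respect to $\mathcal E$-horizontal variations fixing the endpoints, such that its left logarithmic derivative $U$ satisfies $\dot U=\mathrm{pr}_{\mathrm{Vect}_0S^1}\mathrm{ad}_U^\top(U+\Lambda)$, $\dot\Lambda=\mathrm{pr}_{\widehat{\mathfrak k}}\,\mathrm{ad}_U^\top(U+\Lambda)$ for some smooth curve $\Lambda\colon I\to\widehat{\mathfrak k}$. *)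

theory Defs
  imports "HOL-Analysis.Analysis"
begin

section \<open>Smooth maps\<close>

text \<open>Used for \<open>S\<close> a product of nondegenerate intervals, where the derivative within \<open>S\<close>
  is unique; at boundary points it is one-sided.\<close>

primrec times_diff_on :: "nat \<Rightarrow> 'a::euclidean_space set \<Rightarrow> ('a \<Rightarrow> real) \<Rightarrow> bool" where
  "times_diff_on 0 S f \<longleftrightarrow> continuous_on S f"
| "times_diff_on (Suc n) S f \<longleftrightarrow>
     (\<forall>x\<in>S. f differentiable (at x within S)) \<and>
     (\<forall>v. times_diff_on n S (\<lambda>x. frechet_derivative f (at x within S) v))"

definition smooth_on :: "'a::euclidean_space set \<Rightarrow> ('a \<Rightarrow> real) \<Rightarrow> bool" where
  "smooth_on S f \<longleftrightarrow> (\<forall>n. times_diff_on n S f)"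


section \<open>The group $\mathcal G_{\mu\nu}$ and its Lie algebra\<close>

text \<open>Elements of the group, of its Lie algebra and of its tangent spaces are all pairs of a
  function on the real line and a real number.\<close>

type_synonym gpair = "(real \<Rightarrow> real) \<times> real"

definition Diff :: "(real \<Rightarrow> real) set" where
  "Diff = {\<phi>. bij \<phi> \<and> strict_mono \<phi> \<and> smooth_on UNIV \<phi> \<and> smooth_on UNIV (inv \<phi>) \<and>
              (\<forall>\<theta>. \<phi> (\<theta> + 2 * pi) = \<phi> \<theta> + 2 * pi)}"

definition Vect :: "(real \<Rightarrow> real) set" where
  "Vect = {x. smooth_on UNIV x \<and> (\<forall>\<theta>. x (\<theta> + 2 * pi) = x \<theta>)}"

definition cocycle_A :: "(real \<Rightarrow> real) \<Rightarrow> (real \<Rightarrow> real) \<Rightarrow> real" where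
  "cocycle_A \<phi>1 \<phi>2 = 1 / (4 * pi) *
     integral {0..2 * pi} (\<lambda>\<theta>. - \<phi>1 (\<phi>2 \<theta>) + \<phi>1 \<theta> + \<phi>2 \<theta> - \<theta>)"

definition cocycle_B :: "(real \<Rightarrow> real) \<Rightarrow> (real \<Rightarrow> real) \<Rightarrow> real" where
  "cocycle_B \<phi>1 \<phi>2 = 1 / (4 * pi) *
     integral {0..2 * pi}
       (\<lambda>\<theta>. ln (deriv (\<phi>1 \<circ> \<phi>2) \<theta>) * deriv (\<lambda>\<sigma>. ln (deriv \<phi>2 \<sigma>)) \<theta>)"

definition grp :: "gpair set" where
  "grp = Diff \<times> UNIV"

definition gone :: gpair where
  "gone = (id, 0)"

definition gmul :: "real \<Rightarrow> real \<Rightarrow> gpair \<Rightarrow> gpair \<Rightarrow> gpair" where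
  "gmul \<mu> \<nu> g h = (fst g \<circ> fst h,
     snd g + snd h + \<mu> * cocycle_A (fst g) (fst h) + \<nu> * cocycle_B (fst g) (fst h))"

definition ginv :: "real \<Rightarrow> real \<Rightarrow> gpair \<Rightarrow> gpair" where
  "ginv \<mu> \<nu> g = (inv (fst g),
     - snd g - \<mu> * cocycle_A (fst g) (inv (fst g)) - \<nu> * cocycle_B (fst g) (inv (fst g)))"

lemma gmul_ginv: "g \<in> grp \<Longrightarrow> gmul \<mu> \<nu> g (ginv \<mu> \<nu> g) = gone"
  by (auto simp: grp_def Diff_def gmul_def ginv_def gone_def fun_eq_iff bij_is_surj surj_f_inv_f)

definition galg :: "gpair set" where
  "galg = Vect \<times> UNIV"

definition vbracket :: "(real \<Rightarrow> real) \<Rightarrow> (real \<Rightarrow> real) \<Rightarrow> real \<Rightarrow> real" where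
  "vbracket x y = (\<lambda>\<theta>. deriv x \<theta> * y \<theta> - deriv y \<theta> * x \<theta>)"

definition omega :: "real \<Rightarrow> real \<Rightarrow> (real \<Rightarrow> real) \<Rightarrow> (real \<Rightarrow> real) \<Rightarrow> real" where
  "omega \<mu> \<nu> x y = 1 / (2 * pi) *
     integral {0..2 * pi}
       (\<lambda>\<theta>. \<mu> * x \<theta> * deriv y \<theta> + \<nu> * deriv x \<theta> * deriv (deriv y) \<theta>)"

definition gbracket :: "real \<Rightarrow> real \<Rightarrow> gpair \<Rightarrow> gpair \<Rightarrow> gpair" where
  "gbracket \<mu> \<nu> X Y = (vbracket (fst X) (fst Y), omega \<mu> \<nu> (fst X) (fst Y))"

definition eta :: "(real \<Rightarrow> real) \<Rightarrow> real" where
  "eta x = 1 / (2 * pi) * integral {0..2 * pi} x"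

definition Vect0 :: "(real \<Rightarrow> real) set" where
  "Vect0 = {x \<in> Vect. eta x = 0}"

definition kalg :: "gpair set" where
  "kalg = {((\<lambda>\<theta>. a0), a) | a0 a. True}"

text \<open>The projections of the decomposition $\mathfrak g_{\mu\nu} =
  \mathrm{Vect}_0 S^1 \oplus \widehat{\mathfrak k}$.\<close>

definition pr_Vect0 :: "gpair \<Rightarrow> gpair" where
  "pr_Vect0 X = ((\<lambda>\<theta>. fst X \<theta> - eta (fst X)), 0)"

definition pr_kalg :: "gpair \<Rightarrow> gpair" where
  "pr_kalg X = ((\<lambda>\<theta>. eta (fst X)), snd X)"

definition gadd :: "gpair \<Rightarrow> gpair \<Rightarrow> gpair" where
  "gadd X Y = ((\<lambda>\<theta>. fst X \<theta> + fst Y \<theta>), snd X + snd Y)"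

definition gscale :: "real \<Rightarrow> gpair \<Rightarrow> gpair" where
  "gscale s X = ((\<lambda>\<theta>. s * fst X \<theta>), s * snd X)"

definition Lop :: "real \<Rightarrow> real \<Rightarrow> (real \<Rightarrow> real) \<Rightarrow> real \<Rightarrow> real" where
  "Lop \<alpha> \<beta> x = (\<lambda>\<theta>. \<beta> * deriv (deriv x) \<theta> - \<alpha> * x \<theta>)"


section \<open>Inner products and the transpose of $\mathrm{ad}$\<close>

definition vip :: "real \<Rightarrow> real \<Rightarrow> (real \<Rightarrow> real) \<Rightarrow> (real \<Rightarrow> real) \<Rightarrow> real" where
  "vip \<alpha> \<beta> x y = 1 / (2 * pi) *
     integral {0..2 * pi}
       (\<lambda>\<theta>. \<alpha> * (x \<theta> - eta x) * (y \<theta> - eta y) + \<beta> * deriv x \<theta> * deriv y \<theta>)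
     + eta x * eta y"

definition gip :: "real \<Rightarrow> real \<Rightarrow> gpair \<Rightarrow> gpair \<Rightarrow> real" where
  "gip \<alpha> \<beta> X Y = vip \<alpha> \<beta> (fst X) (fst Y) + snd X * snd Y"

text \<open>\<open>is_ad_top \<mu> \<nu> \<alpha> \<beta> U V W\<close> says $W = \mathrm{ad}_U^\top V$; such a \<open>W\<close> is unique when
  the inner product is nondegenerate.\<close>

definition is_ad_top :: "real \<Rightarrow> real \<Rightarrow> real \<Rightarrow> real \<Rightarrow> gpair \<Rightarrow> gpair \<Rightarrow> gpair \<Rightarrow> bool" where
  "is_ad_top \<mu> \<nu> \<alpha> \<beta> U V W \<longleftrightarrow>
     W \<in> galg \<and> (\<forall>Z\<in>galg. gip \<alpha> \<beta> W Z = gip \<alpha> \<beta> V (gbracket \<mu> \<nu> U Z))"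


section \<open>The sub-Riemannian structure\<close>

text \<open>The differential at \<open>h\<close> of left translation by \<open>g\<close>, applied to \<open>X\<close>. The group of
  diffeomorphisms is open in the affine space \<open>id + Vect\<close>, so tangent vectors at \<open>h\<close> are pairs
  \<open>X \<in> Vect \<times> UNIV\<close> and \<open>h + s X\<close> is a curve in the group for small \<open>s\<close>.\<close>

definition dleft :: "real \<Rightarrow> real \<Rightarrow> gpair \<Rightarrow> gpair \<Rightarrow> gpair \<Rightarrow> gpair" where
  "dleft \<mu> \<nu> g h X =
     ((\<lambda>\<theta>. deriv (\<lambda>s. fst (gmul \<mu> \<nu> g (gadd h (gscale s X))) \<theta>) 0),
      deriv (\<lambda>s. snd (gmul \<mu> \<nu> g (gadd h (gscale s X)))) 0)"

definition Ebundle :: "real \<Rightarrow> real \<Rightarrow> gpair \<Rightarrow> gpair set" where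
  "Ebundle \<mu> \<nu> g = dleft \<mu> \<nu> g gone ` (Vect0 \<times> {0})"

definition hmetric :: "real \<Rightarrow> real \<Rightarrow> real \<Rightarrow> real \<Rightarrow> gpair \<Rightarrow> gpair \<Rightarrow> gpair \<Rightarrow> real" where
  "hmetric \<mu> \<nu> \<alpha> \<beta> g X Y =
     gip \<alpha> \<beta> (dleft \<mu> \<nu> (ginv \<mu> \<nu> g) g X) (dleft \<mu> \<nu> (ginv \<mu> \<nu> g) g Y)"

text \<open>Curves on \<open>[0,1]\<close> are functions of a real parameter whose values outside \<open>[0,1]\<close> are
  irrelevant.\<close>

definition smooth_curve :: "(real \<Rightarrow> gpair) \<Rightarrow> bool" where
  "smooth_curve c \<longleftrightarrow>
     smooth_on ({0..1} \<times> UNIV) (\<lambda>(t, \<theta>). fst (c t) \<theta>) \<and> smooth_on {0..1} (\<lambda>t. snd (c t))"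

definition tdot :: "(real \<Rightarrow> real \<Rightarrow> real) \<Rightarrow> real \<Rightarrow> real \<Rightarrow> real" where
  "tdot f t = (\<lambda>\<theta>. vector_derivative (\<lambda>s. f s \<theta>) (at t within {0..1}))"

definition cdot :: "(real \<Rightarrow> gpair) \<Rightarrow> real \<Rightarrow> gpair" where
  "cdot c t =
     (tdot (\<lambda>s. fst (c s)) t, vector_derivative (\<lambda>s. snd (c s)) (at t within {0..1}))"

definition left_log_deriv :: "real \<Rightarrow> real \<Rightarrow> (real \<Rightarrow> gpair) \<Rightarrow> real \<Rightarrow> gpair" where
  "left_log_deriv \<mu> \<nu> c t = dleft \<mu> \<nu> (ginv \<mu> \<nu> (c t)) (c t) (cdot c t)"

definition horizontal :: "real \<Rightarrow> real \<Rightarrow> (real \<Rightarrow> gpair) \<Rightarrow> bool" where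
  "horizontal \<mu> \<nu> c \<longleftrightarrow>
     smooth_curve c \<and> (\<forall>t\<in>{0..1}. c t \<in> grp \<and> cdot c t \<in> Ebundle \<mu> \<nu> (c t))"

definition energy :: "real \<Rightarrow> real \<Rightarrow> real \<Rightarrow> real \<Rightarrow> (real \<Rightarrow> gpair) \<Rightarrow> real" where
  "energy \<mu> \<nu> \<alpha> \<beta> c =
     1 / 2 * integral {0..1} (\<lambda>t. hmetric \<mu> \<nu> \<alpha> \<beta> (c t) (cdot c t) (cdot c t))"

definition horizontal_variation ::
    "real \<Rightarrow> real \<Rightarrow> (real \<Rightarrow> gpair) \<Rightarrow> real \<Rightarrow> (real \<Rightarrow> real \<Rightarrow> gpair) \<Rightarrow> bool" where
  "horizontal_variation \<mu> \<nu> c \<epsilon> C \<longleftrightarrow>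
     smooth_on ({-\<epsilon><..<\<epsilon>} \<times> {0..1} \<times> UNIV) (\<lambda>(s, t, \<theta>). fst (C s t) \<theta>) \<and>
     smooth_on ({-\<epsilon><..<\<epsilon>} \<times> {0..1}) (\<lambda>(s, t). snd (C s t)) \<and>
     (\<forall>s\<in>{-\<epsilon><..<\<epsilon>}. horizontal \<mu> \<nu> (C s) \<and> C s 0 = c 0 \<and> C s 1 = c 1) \<and>
     (\<forall>t\<in>{0..1}. C 0 t = c t)"

definition critical :: "real \<Rightarrow> real \<Rightarrow> real \<Rightarrow> real \<Rightarrow> (real \<Rightarrow> gpair) \<Rightarrow> bool" where
  "critical \<mu> \<nu> \<alpha> \<beta> c \<longleftrightarrow> horizontal \<mu> \<nu> c \<and>
     (\<forall>\<epsilon> C. 0 < \<epsilon> \<and> horizontal_variation \<mu> \<nu> c \<epsilon> C \<longrightarrow>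
        ((\<lambda>s. energy \<mu> \<nu> \<alpha> \<beta> (C s)) has_real_derivative 0) (at 0))"

definition normal_geodesic :: "real \<Rightarrow> real \<Rightarrow> real \<Rightarrow> real \<Rightarrow> (real \<Rightarrow> gpair) \<Rightarrow> bool" where
  "normal_geodesic \<mu> \<nu> \<alpha> \<beta> c \<longleftrightarrow> critical \<mu> \<nu> \<alpha> \<beta> c \<and>
     (\<exists>\<Lambda>. smooth_curve \<Lambda> \<and> (\<forall>t\<in>{0..1}. \<Lambda> t \<in> kalg) \<and>
        (\<forall>t\<in>{0..1}. \<exists>W.
           is_ad_top \<mu> \<nu> \<alpha> \<beta> (left_log_deriv \<mu> \<nu> c t)
             (gadd (left_log_deriv \<mu> \<nu> c t) (\<Lambda> t)) W \<and>
           cdot (left_log_deriv \<mu> \<nu> c) t = pr_Vect0 W \<and>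
           cdot \<Lambda> t = pr_kalg W))"

end

theory Submission
  imports Defs
begin

text \<open>Left translating a horizontal vector back to the identity recovers its preimage \<open>(u, 0)\<close>
  pointwise in time. Testing the transpose identity for $W = \mathrm{ad}_U^\top (U + \Lambda)$
  against \<open>(0, 1)\<close> and \<open>(1, 0)\<close> shows that \<open>W\<close> has no component in $\widehat{\mathfrak k}$,
  since both are annihilated by the pairing after integration by parts. Hence $\Lambda$ is
  constant, which gives the two multipliers, and \<open>u\<close> evolves by the first component of \<open>W\<close>;
  testing against arbitrary vector fields yields the equation.\<close>

section \<open>Smooth functions on the line\<close>

lemma frechet_derivative_real:
  fixes f :: "real \<Rightarrow> real"
  assumes "f differentiable (at x)"
  shows "frechet_derivative f (at x) v = v * deriv f x"
proof -
  have "(f has_real_derivative deriv f x) (at x)"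
    using assms DERIV_deriv_iff_real_differentiable by blast
  then have "(f has_derivative (\<lambda>h. deriv f x * h)) (at x)"
    by (simp add: has_field_derivative_def)
  then show ?thesis
    by (metis frechet_derivative_at mult.commute)
qed

lemma times_diff_on_Suc_real:
  fixes f :: "real \<Rightarrow> real"
  shows "times_diff_on (Suc n) UNIV f \<longleftrightarrow>
    (\<forall>x. f differentiable (at x)) \<and> (\<forall>v. times_diff_on n UNIV (\<lambda>x. v * deriv f x))"
  by (auto simp: frechet_derivative_real)

declare times_diff_on.simps(2) [simp del]

text \<open>The recursion in \<open>times_diff_on\<close> ranges over all directions
  \<open>v\<close>, which on the line means all multiples \<open>v * deriv f x\<close>. Closure
  under scalar multiples reduces them to the single direction \<open>v = 1\<close>.\<close>

lemma times_diff_on_cmult: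
  fixes f :: "real \<Rightarrow> real"
  shows "times_diff_on n UNIV f \<Longrightarrow> times_diff_on n UNIV (\<lambda>x. c * f x)"
proof (induction n arbitrary: f c)
  case 0
  then show ?case by (auto intro: continuous_intros)
next
  case (Suc n)
  then have "\<And>x. deriv (\<lambda>x. c * f x) x = c * deriv f x"
    by (intro deriv_cmult) (auto simp: times_diff_on_Suc_real
        field_differentiable_def real_differentiable_def)
  then have "(\<lambda>x. v * deriv (\<lambda>x. c * f x) x) = (\<lambda>x. (v * c) * deriv f x)" for v
    by (simp add: mult.assoc)
  with Suc.prems show ?case
    unfolding times_diff_on_Suc_real by (auto intro: differentiable_mult)
qed

lemma times_diff_on_Suc_iff_deriv:
  fixes f :: "real \<Rightarrow> real"
  shows "times_diff_on (Suc n) UNIV f \<longleftrightarrow>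
    (\<forall>x. (f has_real_derivative deriv f x) (at x)) \<and> times_diff_on n UNIV (deriv f)"
  unfolding times_diff_on_Suc_real DERIV_deriv_iff_real_differentiable
  using times_diff_on_cmult[of n "deriv f"] by (auto dest: spec[where x = "1::real"])

lemma times_diff_on_SucI:
  fixes f :: "real \<Rightarrow> real"
  assumes "\<And>x. (f has_real_derivative f' x) (at x)" "times_diff_on n UNIV f'"
  shows "times_diff_on (Suc n) UNIV f"
proof -
  have "deriv f = f'"
    using assms(1) by (auto intro: DERIV_imp_deriv)
  then show ?thesis
    using assms by (simp add: times_diff_on_Suc_iff_deriv)
qed

lemma times_diff_on_SucD:
  fixes f :: "real \<Rightarrow> real"
  shows "times_diff_on (Suc n) UNIV f \<Longrightarrow> times_diff_on n UNIV f"
proof (induction n arbitrary: f)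
  case 0
  then show ?case
    by (auto simp: times_diff_on_Suc_iff_deriv intro!: DERIV_continuous_on)
next
  case (Suc n)
  then show ?case
    by (subst times_diff_on_Suc_iff_deriv) (auto simp: times_diff_on_Suc_iff_deriv)
qed

lemma times_diff_on_const: "times_diff_on n UNIV (\<lambda>x::real. c :: real)"
proof (induction n arbitrary: c)
  case (Suc n)
  then show ?case by (intro times_diff_on_SucI[where f' = "\<lambda>_. 0"]) auto
qed simp

lemma times_diff_on_add:
  fixes f g :: "real \<Rightarrow> real"
  shows "times_diff_on n UNIV f \<Longrightarrow> times_diff_on n UNIV g \<Longrightarrow>
    times_diff_on n UNIV (\<lambda>x. f x + g x)"
proof (induction n arbitrary: f g)
  case (Suc n)
  then show ?case
    by (intro times_diff_on_SucI[where f' = "\<lambda>x. deriv f x + deriv g x"])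
       (auto simp: times_diff_on_Suc_iff_deriv intro: DERIV_add)
qed (auto intro: continuous_intros)

lemma times_diff_on_mult:
  fixes f g :: "real \<Rightarrow> real"
  shows "times_diff_on n UNIV f \<Longrightarrow> times_diff_on n UNIV g \<Longrightarrow>
    times_diff_on n UNIV (\<lambda>x. f x * g x)"
proof (induction n arbitrary: f g)
  case (Suc n)
  \<comment> \<open>In the derivative of a product each factor also occurs undifferentiated, so its
    order has to be lowered from \<open>Suc n\<close> to \<open>n\<close> before the induction
    hypothesis applies.\<close>
  then have "times_diff_on n UNIV (\<lambda>x. deriv f x * g x + deriv g x * f x)"
    using times_diff_on_SucD[OF Suc.prems(1)] times_diff_on_SucD[OF Suc.prems(2)]
    by (auto simp: times_diff_on_Suc_iff_deriv intro!: times_diff_on_add Suc.IH)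
  with Suc.prems show ?case
    by (intro times_diff_on_SucI[where f' = "\<lambda>x. deriv f x * g x + deriv g x * f x"])
       (auto simp: times_diff_on_Suc_iff_deriv intro!: DERIV_mult)
qed (auto intro: continuous_intros)

lemma smooth_DERIV:
  fixes f :: "real \<Rightarrow> real"
  assumes "smooth_on UNIV f"
  shows "(f has_real_derivative deriv f x) (at x)"
  using assms times_diff_on_Suc_iff_deriv unfolding smooth_on_def by blast

lemma smooth_deriv:
  fixes f :: "real \<Rightarrow> real"
  shows "smooth_on UNIV f \<Longrightarrow> smooth_on UNIV (deriv f)"
  using times_diff_on_Suc_iff_deriv unfolding smooth_on_def by blast

lemma smooth_continuous_on:
  fixes f :: "real \<Rightarrow> real"
  shows "smooth_on UNIV f \<Longrightarrow> continuous_on S f"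
  unfolding smooth_on_def by (metis continuous_on_subset subset_UNIV times_diff_on.simps(1))

text \<open>The offset \<open>q\<close> covers two cases at once: periodic functions, with
  \<open>q = 0\<close>, and diffeomorphisms, which advance by \<open>2 * pi\<close> over a period
  and still have periodic derivatives.\<close>

lemma deriv_shift_periodic:
  fixes f :: "real \<Rightarrow> real"
  assumes f: "smooth_on UNIV f" and per: "\<And>\<theta>. f (\<theta> + p) = f \<theta> + q"
  shows "deriv f (\<theta> + p) = deriv f \<theta>"
proof -
  have "((\<lambda>\<sigma>. f (\<sigma> + p)) has_real_derivative deriv f (\<theta> + p)) (at \<theta>)"
    by (intro iffD1[OF DERIV_shift] smooth_DERIV[OF f])
  moreover have "((\<lambda>\<sigma>. f \<sigma> + q) has_real_derivative deriv f \<theta>) (at \<theta>)"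
    by (auto intro!: derivative_eq_intros smooth_DERIV[OF f])
  ultimately show ?thesis
    by (simp add: per DERIV_unique)
qed

section \<open>Vector fields on the circle: closure properties of \<open>Vect\<close>\<close>

lemma Vect_smooth: "x \<in> Vect \<Longrightarrow> smooth_on UNIV x"
  by (simp add: Vect_def)

lemma Vect_DERIV: "x \<in> Vect \<Longrightarrow> (x has_real_derivative deriv x \<theta>) (at \<theta>)"
  by (simp add: Vect_smooth smooth_DERIV)

lemma Vect_continuous_on: "x \<in> Vect \<Longrightarrow> continuous_on S x"
  by (simp add: Vect_smooth smooth_continuous_on)

lemma Vect_periodic: "x \<in> Vect \<Longrightarrow> x (2 * pi) = x 0"
  unfolding Vect_def by (metis (mono_tags, lifting) add_0 mem_Collect_eq)

lemma Vect_deriv: "x \<in> Vect \<Longrightarrow> deriv x \<in> Vect"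
  using deriv_shift_periodic[of x "2 * pi" 0] by (auto simp: Vect_def smooth_deriv)

lemma Vect_const: "(\<lambda>\<theta>. c) \<in> Vect"
  by (auto simp: Vect_def smooth_on_def times_diff_on_const)

lemma Vect_add: "x \<in> Vect \<Longrightarrow> y \<in> Vect \<Longrightarrow> (\<lambda>\<theta>. x \<theta> + y \<theta>) \<in> Vect"
  by (auto simp: Vect_def smooth_on_def times_diff_on_add)

lemma Vect_mult: "x \<in> Vect \<Longrightarrow> y \<in> Vect \<Longrightarrow> (\<lambda>\<theta>. x \<theta> * y \<theta>) \<in> Vect"
  by (auto simp: Vect_def smooth_on_def times_diff_on_mult)

lemma Vect_diff: "x \<in> Vect \<Longrightarrow> y \<in> Vect \<Longrightarrow> (\<lambda>\<theta>. x \<theta> - y \<theta>) \<in> Vect"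
  using Vect_add[OF _ Vect_mult[OF Vect_const[of "- 1"]], of x y] by simp

lemmas Vect_intros = Vect_deriv Vect_const Vect_add Vect_mult Vect_diff

lemma deriv_add_const: "deriv (\<lambda>\<theta>. x \<theta> + c) = deriv x" if "x \<in> Vect" for x :: "real \<Rightarrow> real"
  by (auto intro!: ext DERIV_imp_deriv derivative_eq_intros Vect_DERIV[OF that])

section \<open>The differential of left translations\<close>

text \<open>Write \<open>p + s q = p (1 + s q / p)\<close>; a bound \<open>M\<close> for
  \<open>q / p\<close> on the compact interval yields the radius \<open>1 / M\<close>, uniform in
  the angle. This keeps the derivative of a perturbed diffeomorphism positive over a whole period,
  so that the logarithm in \<open>cocycle_B\<close> stays differentiable.\<close>

lemma positive_perturbation:
  fixes p q :: "real \<Rightarrow> real"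
  assumes "continuous_on {a..b} p" "continuous_on {a..b} q" "\<And>\<theta>. p \<theta> > 0"
  obtains \<delta> where "\<delta> > 0" "\<And>s \<theta>. \<lbrakk>\<bar>s\<bar> < \<delta>; \<theta> \<in> {a..b}\<rbrakk> \<Longrightarrow> p \<theta> + s * q \<theta> > 0"
proof -
  have "continuous_on {a..b} (\<lambda>\<theta>. q \<theta> / p \<theta>)"
    using assms(1,2) less_imp_neq[OF assms(3)] by (auto intro!: continuous_intros)
  then have "bounded ((\<lambda>\<theta>. q \<theta> / p \<theta>) ` {a..b})"
    by (intro compact_imp_bounded compact_continuous_image) auto
  then obtain M where M: "M > 0" "\<And>\<theta>. \<theta> \<in> {a..b} \<Longrightarrow> \<bar>q \<theta> / p \<theta>\<bar> \<le> M"
    unfolding bounded_pos by auto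
  show ?thesis
  proof (rule that[of "1 / M"])
    fix s \<theta> assume s: "\<bar>s\<bar> < 1 / M" and \<theta>: "\<theta> \<in> {a..b}"
    have "\<bar>s * (q \<theta> / p \<theta>)\<bar> \<le> \<bar>s\<bar> * M"
      using M(2)[OF \<theta>] by (simp only: abs_mult mult_left_mono abs_ge_zero)
    also have "\<dots> < 1"
      using s M(1) by (simp add: field_simps)
    finally have "0 < 1 + s * (q \<theta> / p \<theta>)" by linarith
    then have "0 < p \<theta> * (1 + s * (q \<theta> / p \<theta>))"
      using assms(3) by simp
    also have "\<dots> = p \<theta> + s * q \<theta>"
      using assms(3)[of \<theta>] by (simp add: field_simps)
    finally show "p \<theta> + s * q \<theta> > 0" .
  qed (use M in auto)
qed

section \<open>Differentiating the two cocycles under the integral sign\<close>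

lemma continuous_on_snd_compose:
  "smooth_on UNIV (f :: real \<Rightarrow> real) \<Longrightarrow> continuous_on S (\<lambda>z. f (snd z))"
  by (intro continuous_on_compose2[OF smooth_continuous_on[of f UNIV]] continuous_intros) auto

lemma has_derivative_cocycle_A:
  assumes f: "smooth_on UNIV f" and p: "smooth_on UNIV p" and y: "smooth_on UNIV y"
  shows "((\<lambda>s. cocycle_A f (\<lambda>\<theta>. p \<theta> + s * y \<theta>)) has_real_derivative
    1 / (4 * pi) * integral {0..2 * pi} (\<lambda>\<theta>. y \<theta> - deriv f (p \<theta>) * y \<theta>)) (at 0)"
proof -
  define G where "G = (\<lambda>s \<theta>. - f (p \<theta> + s * y \<theta>) + f \<theta> + (p \<theta> + s * y \<theta>) - \<theta>)"
  define G' where "G' = (\<lambda>s \<theta>. y \<theta> - deriv f (p \<theta> + s * y \<theta>) * y \<theta>)"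
  have "((\<lambda>s. integral (cbox 0 (2 * pi)) (G s)) has_real_derivative
      integral (cbox 0 (2 * pi)) (G' 0)) (at 0 within UNIV)"
  proof (rule leibniz_rule_field_derivative)
    fix s \<theta> :: real
    show "((\<lambda>s. G s \<theta>) has_real_derivative G' s \<theta>) (at s within UNIV)"
      unfolding G_def G'_def
      by (auto intro!: derivative_eq_intros DERIV_chain2[OF smooth_DERIV[OF f]])
  next
    fix s :: real
    show "G s integrable_on cbox 0 (2 * pi)"
      unfolding G_def
      by (intro integrable_continuous continuous_intros smooth_continuous_on f p y
          continuous_on_compose2[OF smooth_continuous_on[OF f, of UNIV]]) auto
  next
    show "continuous_on (UNIV \<times> cbox 0 (2 * pi)) (\<lambda>(s, \<theta>). G' s \<theta>)"
      unfolding G'_def split_beta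
      by (intro continuous_intros continuous_on_snd_compose p y
          continuous_on_compose2[OF smooth_continuous_on[OF smooth_deriv[OF f], of UNIV]]) auto
  qed auto
  then show ?thesis
    unfolding cocycle_A_def G_def G'_def by (intro DERIV_cmult) simp
qed

text \<open>Leibniz rule on a small interval of \<open>s\<close>. The first summand comes from
  differentiating the logarithm of the derivative of the composite, the second from differentiating
  the quotient of second by first derivative of the perturbed map.\<close>

lemma has_derivative_cocycle_B:
  assumes f: "smooth_on UNIV f" and p: "smooth_on UNIV p" and y: "smooth_on UNIV y"
    and fpos: "\<And>\<theta>. deriv f \<theta> > 0" and ppos: "\<And>\<theta>. deriv p \<theta> > 0"
  shows "((\<lambda>s. cocycle_B f (\<lambda>\<theta>. p \<theta> + s * y \<theta>)) has_real_derivative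
    1 / (4 * pi) * integral {0..2 * pi} (\<lambda>\<theta>.
      (deriv (deriv f) (p \<theta>) * y \<theta> / deriv f (p \<theta>) + deriv y \<theta> / deriv p \<theta>)
        * (deriv (deriv p) \<theta> / deriv p \<theta>)
      + ln (deriv f (p \<theta>) * deriv p \<theta>)
        * ((deriv (deriv y) \<theta> * deriv p \<theta> - deriv (deriv p) \<theta> * deriv y \<theta>) / (deriv p \<theta>)\<^sup>2)))
    (at 0)"
proof -
  note f1 = smooth_deriv[OF f] and p1 = smooth_deriv[OF p] and y1 = smooth_deriv[OF y]
  note f2 = smooth_deriv[OF f1] and p2 = smooth_deriv[OF p1] and y2 = smooth_deriv[OF y1]
  obtain \<delta> where \<delta>: "\<delta> > 0"
    "\<And>s \<theta>. \<lbrakk>\<bar>s\<bar> < \<delta>; \<theta> \<in> {0..2 * pi}\<rbrakk> \<Longrightarrow> deriv p \<theta> + s * deriv y \<theta> > 0"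
    using positive_perturbation[of 0 "2 * pi" "deriv p" "deriv y"] ppos
      smooth_continuous_on[OF p1] smooth_continuous_on[OF y1] by blast
  define U where "U = {-\<delta><..<\<delta>}"
  define G where "G = (\<lambda>s \<theta>. ln (deriv f (p \<theta> + s * y \<theta>) * (deriv p \<theta> + s * deriv y \<theta>))
     * ((deriv (deriv p) \<theta> + s * deriv (deriv y) \<theta>) / (deriv p \<theta> + s * deriv y \<theta>)))"
  define G' where "G' = (\<lambda>s \<theta>.
      (deriv (deriv f) (p \<theta> + s * y \<theta>) * y \<theta> / deriv f (p \<theta> + s * y \<theta>)
        + deriv y \<theta> / (deriv p \<theta> + s * deriv y \<theta>))
        * ((deriv (deriv p) \<theta> + s * deriv (deriv y) \<theta>) / (deriv p \<theta> + s * deriv y \<theta>))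
      + ln (deriv f (p \<theta> + s * y \<theta>) * (deriv p \<theta> + s * deriv y \<theta>))
        * ((deriv (deriv y) \<theta> * (deriv p \<theta> + s * deriv y \<theta>)
            - (deriv (deriv p) \<theta> + s * deriv (deriv y) \<theta>) * deriv y \<theta>)
           / (deriv p \<theta> + s * deriv y \<theta>)\<^sup>2))"
  have pos: "deriv p \<theta> + s * deriv y \<theta> > 0" if "s \<in> U" "\<theta> \<in> {0..2 * pi}" for s \<theta>
    using \<delta>(2)[of s \<theta>] that by (auto simp: U_def)
  note nz = less_imp_neq[OF fpos, symmetric] less_imp_neq[OF pos, symmetric]
  have Dpy: "((\<lambda>\<theta>. p \<theta> + s * y \<theta>) has_real_derivative (deriv p \<theta> + s * deriv y \<theta>)) (at \<theta>)"
    for s \<theta>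
    by (auto intro!: derivative_eq_intros smooth_DERIV p y)
  have Dpy1: "((\<lambda>\<theta>. deriv p \<theta> + s * deriv y \<theta>) has_real_derivative
      (deriv (deriv p) \<theta> + s * deriv (deriv y) \<theta>)) (at \<theta>)" for s \<theta>
    by (auto intro!: derivative_eq_intros smooth_DERIV p1 y1)
  \<comment> \<open>The nested \<open>deriv\<close> terms of \<open>cocycle_B\<close> take the
    closed form \<open>G\<close> where the perturbed derivative is positive, which is secured for
    \<open>s\<close> in \<open>U\<close> and angles in one period.\<close>
  have integrand: "ln (deriv (f \<circ> (\<lambda>\<theta>. p \<theta> + s * y \<theta>)) \<theta>)
      * deriv (\<lambda>\<sigma>. ln (deriv (\<lambda>\<theta>. p \<theta> + s * y \<theta>) \<sigma>)) \<theta> = G s \<theta>"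
    if "s \<in> U" "\<theta> \<in> {0..2 * pi}" for s \<theta>
  proof -
    have "deriv (\<lambda>\<theta>. p \<theta> + s * y \<theta>) = (\<lambda>\<theta>. deriv p \<theta> + s * deriv y \<theta>)"
      using Dpy by (auto intro: DERIV_imp_deriv)
    moreover have "deriv (\<lambda>\<sigma>. ln (deriv p \<sigma> + s * deriv y \<sigma>)) \<theta>
      = (deriv (deriv p) \<theta> + s * deriv (deriv y) \<theta>) / (deriv p \<theta> + s * deriv y \<theta>)"
      by (rule DERIV_imp_deriv) (auto intro!: derivative_eq_intros Dpy1 smooth_DERIV p1 y1 pos that)
    moreover have "deriv (f \<circ> (\<lambda>\<theta>. p \<theta> + s * y \<theta>)) \<theta>
      = deriv f (p \<theta> + s * y \<theta>) * (deriv p \<theta> + s * deriv y \<theta>)"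
      by (rule DERIV_imp_deriv, rule DERIV_chain[OF smooth_DERIV[OF f] Dpy])
    ultimately show ?thesis by (simp add: G_def)
  qed
  have "((\<lambda>s. integral (cbox 0 (2 * pi)) (G s)) has_real_derivative
      integral (cbox 0 (2 * pi)) (G' 0)) (at 0 within U)"
  proof (rule leibniz_rule_field_derivative)
    fix s \<theta> :: real
    assume s: "s \<in> U" and \<theta>: "\<theta> \<in> cbox 0 (2 * pi)"
    then have P: "deriv p \<theta> + s * deriv y \<theta> > 0" using pos by simp
    have "((\<lambda>s. ln (deriv f (p \<theta> + s * y \<theta>) * (deriv p \<theta> + s * deriv y \<theta>))) has_real_derivative
       (deriv (deriv f) (p \<theta> + s * y \<theta>) * y \<theta> / deriv f (p \<theta> + s * y \<theta>)
        + deriv y \<theta> / (deriv p \<theta> + s * deriv y \<theta>))) (at s)"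
    proof (rule DERIV_cong[OF DERIV_chain2[of ln _
          "\<lambda>s. deriv f (p \<theta> + s * y \<theta>) * (deriv p \<theta> + s * deriv y \<theta>)",
          OF DERIV_ln_divide[OF mult_pos_pos[OF fpos P]]]])
      show "((\<lambda>s. deriv f (p \<theta> + s * y \<theta>) * (deriv p \<theta> + s * deriv y \<theta>)) has_real_derivative
          (deriv (deriv f) (p \<theta> + s * y \<theta>) * y \<theta> * (deriv p \<theta> + s * deriv y \<theta>)
            + deriv y \<theta> * deriv f (p \<theta> + s * y \<theta>))) (at s)"
        by (auto intro!: derivative_eq_intros DERIV_chain2[OF smooth_DERIV[OF f1]])
    qed (use P fpos[of "p \<theta> + s * y \<theta>"] in
        \<open>simp add: add_divide_distrib less_imp_neq[symmetric]\<close>)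
    moreover have "((\<lambda>s. (deriv (deriv p) \<theta> + s * deriv (deriv y) \<theta>)
        / (deriv p \<theta> + s * deriv y \<theta>)) has_real_derivative
       (deriv (deriv y) \<theta> * (deriv p \<theta> + s * deriv y \<theta>)
            - (deriv (deriv p) \<theta> + s * deriv (deriv y) \<theta>) * deriv y \<theta>)
           / (deriv p \<theta> + s * deriv y \<theta>)\<^sup>2) (at s)"
      using P by (auto intro!: derivative_eq_intros simp: power2_eq_square)
    ultimately have "((\<lambda>s. G s \<theta>) has_real_derivative G' s \<theta>) (at s)"
      unfolding G_def G'_def by (rule DERIV_cong[OF DERIV_mult]) (simp add: algebra_simps)
    then show "((\<lambda>s. G s \<theta>) has_real_derivative G' s \<theta>) (at s within U)"
      by (rule has_field_derivative_at_within)
  next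
    fix s assume s: "s \<in> U"
    show "G s integrable_on cbox 0 (2 * pi)"
      unfolding G_def
      using s nz
      by (intro integrable_continuous continuous_intros smooth_continuous_on p y p1 y1 p2 y2
          continuous_on_compose2[OF smooth_continuous_on[OF f1, of UNIV]]) auto
  next
    show "continuous_on (U \<times> cbox 0 (2 * pi)) (\<lambda>(s, \<theta>). G' s \<theta>)"
      unfolding G'_def split_beta
      using nz
      by (intro continuous_intros continuous_on_snd_compose p y p1 y1 p2 y2
          continuous_on_compose2[OF smooth_continuous_on[OF f1, of UNIV]]
          continuous_on_compose2[OF smooth_continuous_on[OF f2, of UNIV]]) auto
  qed (use \<delta> in \<open>auto simp: U_def\<close>)
  then have *: "((\<lambda>s. 1 / (4 * pi) * integral (cbox 0 (2 * pi)) (G s)) has_real_derivative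
      1 / (4 * pi) * integral (cbox 0 (2 * pi)) (G' 0)) (at 0 within U)"
    by (rule DERIV_cmult)
  \<comment> \<open>Since \<open>U\<close> is an open neighbourhood of 0, the derivative within
    \<open>U\<close> is the full derivative, and agreement of the two functions on \<open>U\<close>
    is enough to transfer it.\<close>
  have U: "open U" "0 \<in> U"
    using \<delta>(1) by (auto simp: U_def)
  have eq: "1 / (4 * pi) * integral (cbox 0 (2 * pi)) (G s)
      = cocycle_B f (\<lambda>\<theta>. p \<theta> + s * y \<theta>)" if "s \<in> U" for s
    unfolding cocycle_B_def cbox_interval
    by (rule arg_cong[where f = "(*) _"], rule integral_cong, rule integrand[OF that, symmetric])
  have "((\<lambda>s. cocycle_B f (\<lambda>\<theta>. p \<theta> + s * y \<theta>)) has_real_derivative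
      1 / (4 * pi) * integral (cbox 0 (2 * pi)) (G' 0)) (at 0)"
    using * unfolding at_within_open[OF U(2,1)]
    by (rule has_field_derivative_transform_within_open[OF _ U eq])
  then show ?thesis
    by (simp add: G'_def)
qed

section \<open>Derivatives of circle diffeomorphisms and of their inverses\<close>

lemma Diff_smooth: "\<phi> \<in> Diff \<Longrightarrow> smooth_on UNIV \<phi>"
  and Diff_inv_smooth: "\<phi> \<in> Diff \<Longrightarrow> smooth_on UNIV (inv \<phi>)"
  by (auto simp: Diff_def)

lemma Diff_inv_left: "\<phi> \<in> Diff \<Longrightarrow> inv \<phi> (\<phi> \<theta>) = \<theta>"
  and Diff_inv_right: "\<phi> \<in> Diff \<Longrightarrow> \<phi> (inv \<phi> \<theta>) = \<theta>"
  by (auto simp: Diff_def bij_is_inj bij_is_surj surj_f_inv_f)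

lemma Diff_deriv_inv:
  assumes "\<phi> \<in> Diff"
  shows "deriv (inv \<phi>) (\<phi> \<theta>) * deriv \<phi> \<theta> = 1"
proof -
  have "((\<lambda>\<theta>. inv \<phi> (\<phi> \<theta>)) has_real_derivative deriv (inv \<phi>) (\<phi> \<theta>) * deriv \<phi> \<theta>) (at \<theta>)"
    using assms by (intro DERIV_chain2 smooth_DERIV Diff_smooth Diff_inv_smooth)
  moreover have "((\<lambda>\<theta>. inv \<phi> (\<phi> \<theta>)) has_real_derivative 1) (at \<theta>)"
    using assms by (simp add: Diff_inv_left)
  ultimately show ?thesis
    by (rule DERIV_unique)
qed

text \<open>Monotonicity gives a nonnegative derivative; zeros are excluded by the chain rule for
  the inverse composed with the map, because the inverse is smooth as well.\<close>

lemma Diff_deriv_pos: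
  assumes "\<phi> \<in> Diff"
  shows "deriv \<phi> \<theta> > 0"
proof -
  have "deriv \<phi> \<theta> \<ge> 0"
    using assms by (intro mono_on_imp_deriv_nonneg[of UNIV \<phi> _ \<theta>])
      (auto simp: Diff_def strict_mono_mono smooth_DERIV)
  moreover have "deriv \<phi> \<theta> \<noteq> 0"
    using Diff_deriv_inv[OF assms, of \<theta>] by auto
  ultimately show ?thesis by simp
qed

lemma Diff_deriv_inv_pos:
  assumes "\<phi> \<in> Diff"
  shows "deriv (inv \<phi>) \<theta> > 0"
  using Diff_deriv_inv[OF assms, of "inv \<phi> \<theta>"] Diff_deriv_pos[OF assms, of "inv \<phi> \<theta>"]
  by (metis Diff_inv_right assms zero_less_mult_pos2 zero_less_one)

lemma Diff_deriv_Vect: "\<phi> \<in> Diff \<Longrightarrow> deriv \<phi> \<in> Vect"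
  using deriv_shift_periodic[of \<phi> "2 * pi" "2 * pi"]
  by (auto simp: Diff_def Vect_def smooth_deriv)

section \<open>Explicit formulas for left translation of tangent vectors\<close>

lemma dleft_eq:
  assumes f: "smooth_on UNIV (fst g)" and p: "smooth_on UNIV (fst h)" and y: "smooth_on UNIV y"
    and fpos: "\<And>\<theta>. deriv (fst g) \<theta> > 0" and ppos: "\<And>\<theta>. deriv (fst h) \<theta> > 0"
  shows "dleft \<mu> \<nu> g h (y, a) = ((\<lambda>\<theta>. deriv (fst g) (fst h \<theta>) * y \<theta>),
    a + \<mu> * (1 / (4 * pi) *
      integral {0..2 * pi} (\<lambda>\<theta>. y \<theta> - deriv (fst g) (fst h \<theta>) * y \<theta>))
    + \<nu> * (1 / (4 * pi) * integral {0..2 * pi} (\<lambda>\<theta>.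
      (deriv (deriv (fst g)) (fst h \<theta>) * y \<theta> / deriv (fst g) (fst h \<theta>)
          + deriv y \<theta> / deriv (fst h) \<theta>) * (deriv (deriv (fst h)) \<theta> / deriv (fst h) \<theta>)
      + ln (deriv (fst g) (fst h \<theta>) * deriv (fst h) \<theta>)
        * ((deriv (deriv y) \<theta> * deriv (fst h) \<theta> - deriv (deriv (fst h)) \<theta> * deriv y \<theta>)
            / (deriv (fst h) \<theta>)\<^sup>2))))"
proof -
  have "((\<lambda>s. fst g (fst h \<theta> + s * y \<theta>)) has_real_derivative
      deriv (fst g) (fst h \<theta>) * y \<theta>) (at 0)" for \<theta>
    by (rule DERIV_cong[OF DERIV_chain2[OF smooth_DERIV[OF f]]]) (auto intro!: derivative_eq_intros)
  then show ?thesis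
    unfolding dleft_def gmul_def gadd_def gscale_def
    by (auto intro!: DERIV_imp_deriv derivative_eq_intros
        has_derivative_cocycle_A[OF f p y] has_derivative_cocycle_B[OF f p y fpos ppos]
        simp: mult.commute)
qed

text \<open>Integration by parts on the circle: \<open>F\<close> collects the boundary terms, which
  cancel over a period. Each later use amounts to a choice of \<open>F\<close>.\<close>

lemma integral_cong_deriv:
  fixes a b F :: "real \<Rightarrow> real"
  assumes F: "\<And>\<theta>. (F has_real_derivative a \<theta> - b \<theta>) (at \<theta>)" and per: "F (2 * pi) = F 0"
    and b: "continuous_on {0..2 * pi} b"
  shows "integral {0..2 * pi} a = integral {0..2 * pi} b"
proof -
  have "((\<lambda>\<theta>. a \<theta> - b \<theta>) has_integral F (2 * pi) - F 0) {0..2 * pi}"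
    using F by (intro fundamental_theorem_of_calculus)
      (auto simp: has_real_derivative_iff_has_vector_derivative[symmetric]
        intro: has_field_derivative_at_within)
  from has_integral_add[OF this integrable_integral[OF integrable_continuous_real[OF b]]]
  show ?thesis
    by (simp add: per integral_unique)
qed

text \<open>The identity has first derivative 1 and second derivative 0, so of the variation of
  \<open>cocycle_B\<close> just the logarithmic term with the second derivative of \<open>x\<close>
  survives.\<close>

lemma dleft_gone:
  assumes g: "g \<in> grp" and x: "x \<in> Vect"
  shows "dleft \<mu> \<nu> g gone (x, 0) = ((\<lambda>\<theta>. deriv (fst g) \<theta> * x \<theta>),
    \<mu> * (1 / (4 * pi) * integral {0..2 * pi} (\<lambda>\<theta>. x \<theta> - deriv (fst g) \<theta> * x \<theta>))
    + \<nu> * (1 / (4 * pi) * integral {0..2 * pi}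
        (\<lambda>\<theta>. ln (deriv (fst g) \<theta>) * deriv (deriv x) \<theta>)))"
proof -
  have \<phi>: "fst g \<in> Diff"
    using g by (auto simp: grp_def)
  have id: "deriv id = (\<lambda>\<theta>::real. 1)"
    unfolding id_def by simp
  moreover have "smooth_on UNIV (id :: real \<Rightarrow> real)"
    unfolding smooth_on_def
  proof
    fix n show "times_diff_on n UNIV (id :: real \<Rightarrow> real)"
    proof (cases n)
      case (Suc m)
      then show ?thesis
        by (auto intro!: times_diff_on_SucI[where f' = "\<lambda>_. 1"] times_diff_on_const DERIV_ident
            simp: id_def)
    qed (simp add: id_def)
  qed
  ultimately show ?thesis
    using dleft_eq[of g gone x \<mu> \<nu> 0] \<phi> x
    by (simp add: gone_def Diff_smooth Diff_deriv_pos Vect_smooth)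
qed

text \<open>The variation of the cocycle in the second step, \<open>1 / (4 \<pi>) \<integral> x' (ln \<phi>')'\<close>, cancels that in
  the first step, \<open>1 / (4 \<pi>) \<integral> ln \<phi>' x''\<close>, after integration by parts.\<close>

lemma dleft_ginv_dleft:
  assumes g: "g \<in> grp" and x: "x \<in> Vect"
  shows "dleft \<mu> \<nu> (ginv \<mu> \<nu> g) g (dleft \<mu> \<nu> g gone (x, 0)) = (x, 0)"
proof -
  define \<phi> where "\<phi> = fst g"
  have \<phi>: "\<phi> \<in> Diff"
    using g by (auto simp: grp_def \<phi>_def)
  define y where "y = (\<lambda>\<theta>. deriv \<phi> \<theta> * x \<theta>)"
  have y: "y \<in> Vect"
    unfolding y_def by (intro Vect_intros Diff_deriv_Vect \<phi> x)
  have pos: "deriv \<phi> \<theta> > 0" for \<theta>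
    by (rule Diff_deriv_pos[OF \<phi>])
  have inv1: "deriv (inv \<phi>) (\<phi> \<theta>) = 1 / deriv \<phi> \<theta>" for \<theta>
    using Diff_deriv_inv[OF \<phi>, of \<theta>] pos[of \<theta>] by (simp add: field_simps)
  have D\<phi>: "(\<phi> has_real_derivative deriv \<phi> \<theta>) (at \<theta>)"
      "(deriv \<phi> has_real_derivative deriv (deriv \<phi>) \<theta>) (at \<theta>)" for \<theta>
    using \<phi> by (auto intro: smooth_DERIV smooth_deriv Diff_smooth)
  note Dx = Vect_DERIV[OF x] Vect_DERIV[OF Vect_deriv[OF x]]
  \<comment> \<open>Differentiate \<open>inv1\<close> in the angle and compare with the chain
    rule.\<close>
  have inv2: "deriv (deriv (inv \<phi>)) (\<phi> \<theta>) = - deriv (deriv \<phi>) \<theta> / deriv \<phi> \<theta> ^ 3" for \<theta>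
  proof -
    have "((\<lambda>\<theta>. deriv (inv \<phi>) (\<phi> \<theta>)) has_real_derivative
        deriv (deriv (inv \<phi>)) (\<phi> \<theta>) * deriv \<phi> \<theta>) (at \<theta>)"
      using \<phi> by (intro DERIV_chain2 smooth_DERIV smooth_deriv Diff_smooth Diff_inv_smooth)
    moreover have "((\<lambda>\<theta>. deriv (inv \<phi>) (\<phi> \<theta>)) has_real_derivative
        - deriv (deriv \<phi>) \<theta> / deriv \<phi> \<theta> ^ 2) (at \<theta>)"
      unfolding inv1 using pos[of \<theta>]
      by (auto intro!: derivative_eq_intros D\<phi> simp: power2_eq_square)
    ultimately have "deriv (deriv (inv \<phi>)) (\<phi> \<theta>) * deriv \<phi> \<theta>
        = - deriv (deriv \<phi>) \<theta> / deriv \<phi> \<theta> ^ 2"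
      by (rule DERIV_unique)
    then show ?thesis
      using pos[of \<theta>] by (simp add: field_simps power2_eq_square power3_eq_cube)
  qed
  have y1: "deriv y \<theta> = deriv (deriv \<phi>) \<theta> * x \<theta> + deriv x \<theta> * deriv \<phi> \<theta>" for \<theta>
    unfolding y_def by (intro DERIV_imp_deriv DERIV_mult D\<phi> Dx)
  \<comment> \<open>The coefficient \<open>c\<close> is arbitrary because the argument of the
    logarithm is 1. In the first factor the terms with the second derivative of \<phi> cancel and
    leave \<open>deriv x\<close>.\<close>
  have B: "(deriv (deriv (inv \<phi>)) (\<phi> \<theta>) * y \<theta> / deriv (inv \<phi>) (\<phi> \<theta>)
        + deriv y \<theta> / deriv \<phi> \<theta>) * (deriv (deriv \<phi>) \<theta> / deriv \<phi> \<theta>)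
      + ln (deriv (inv \<phi>) (\<phi> \<theta>) * deriv \<phi> \<theta>) * c
      = deriv x \<theta> * (deriv (deriv \<phi>) \<theta> / deriv \<phi> \<theta>)" for \<theta> c
    using pos[of \<theta>]
    by (simp add: inv1 inv2 y1 y_def[THEN fun_cong] field_simps power2_eq_square power3_eq_cube)
  have parts: "integral {0..2 * pi} (\<lambda>\<theta>. deriv x \<theta> * (deriv (deriv \<phi>) \<theta> / deriv \<phi> \<theta>))
      = integral {0..2 * pi} (\<lambda>\<theta>. - (ln (deriv \<phi> \<theta>) * deriv (deriv x) \<theta>))"
  proof (rule integral_cong_deriv)
    fix \<theta>
    show "((\<lambda>\<theta>. deriv x \<theta> * ln (deriv \<phi> \<theta>)) has_real_derivative
        deriv x \<theta> * (deriv (deriv \<phi>) \<theta> / deriv \<phi> \<theta>)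
        - - (ln (deriv \<phi> \<theta>) * deriv (deriv x) \<theta>)) (at \<theta>)"
      using pos[of \<theta>] by (auto intro!: derivative_eq_intros D\<phi> Dx)
  next
    show "deriv x (2 * pi) * ln (deriv \<phi> (2 * pi)) = deriv x 0 * ln (deriv \<phi> 0)"
      using Vect_periodic[OF Vect_deriv[OF x]] Vect_periodic[OF Diff_deriv_Vect[OF \<phi>]] by simp
  next
    show "continuous_on {0..2 * pi} (\<lambda>\<theta>. - (ln (deriv \<phi> \<theta>) * deriv (deriv x) \<theta>))"
      using less_imp_neq[OF pos, symmetric]
      by (intro continuous_intros Vect_continuous_on Diff_deriv_Vect Vect_deriv \<phi> x) auto
  qed
  \<comment> \<open>The variations of \<open>cocycle_A\<close> in the two translations have opposite
    signs: one step leads from \<open>x\<close> to \<open>y\<close>, the other from \<open>y\<close>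
    back to \<open>x\<close>.\<close>
  have A: "integral {0..2 * pi} (\<lambda>\<theta>. y \<theta> - x \<theta>) = - integral {0..2 * pi} (\<lambda>\<theta>. x \<theta> - y \<theta>)"
    unfolding integral_neg[symmetric] by simp
  have xy: "deriv (inv \<phi>) (\<phi> \<theta>) * y \<theta> = x \<theta>" for \<theta>
    using pos[of \<theta>] by (simp add: inv1 y_def)
  \<comment> \<open>\<open>e\<close> is the central component that \<open>(x, 0)\<close> acquires
    under translation by \<open>g\<close>; translating back has to remove it.\<close>
  define e where "e = \<mu> * (1 / (4 * pi) * integral {0..2 * pi} (\<lambda>\<theta>. x \<theta> - y \<theta>))
    + \<nu> * (1 / (4 * pi) * integral {0..2 * pi} (\<lambda>\<theta>. ln (deriv \<phi> \<theta>) * deriv (deriv x) \<theta>))"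
  have ginv: "fst (ginv \<mu> \<nu> g) = inv \<phi>"
    by (simp add: ginv_def \<phi>_def)
  have "dleft \<mu> \<nu> (ginv \<mu> \<nu> g) g (y, e) = (x, e
      + \<mu> * (1 / (4 * pi) * integral {0..2 * pi} (\<lambda>\<theta>. y \<theta> - x \<theta>))
      + \<nu> * (1 / (4 * pi) * integral {0..2 * pi}
          (\<lambda>\<theta>. deriv x \<theta> * (deriv (deriv \<phi>) \<theta> / deriv \<phi> \<theta>))))"
    by (rule dleft_eq[of "ginv \<mu> \<nu> g" g y \<mu> \<nu> e, unfolded ginv \<phi>_def[symmetric] B xy])
      (intro Diff_smooth Diff_inv_smooth Diff_deriv_pos Diff_deriv_inv_pos Vect_smooth \<phi> y)+
  also have "\<dots> = (x, 0)"
    unfolding A parts e_def by simp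
  finally have "dleft \<mu> \<nu> (ginv \<mu> \<nu> g) g (y, e) = (x, 0)" .
  moreover have "dleft \<mu> \<nu> g gone (x, 0) = (y, e)"
    unfolding dleft_gone[OF g x] e_def y_def \<phi>_def ..
  ultimately show ?thesis by simp
qed

section \<open>The transpose of $\mathrm{ad}$\<close>

lemma eta_add_const: "x \<in> Vect \<Longrightarrow> eta (\<lambda>\<theta>. x \<theta> + c) = eta x + c"
  unfolding eta_def
  by (subst integral_add)
    (auto intro!: integrable_continuous_real Vect_continuous_on simp: field_simps Vect_const)

text \<open>The inertia operator \<open>x \<mapsto> \<alpha> (x - \<eta> x) - \<beta> x'' + \<eta> x\<close> turns \<open>vip\<close> into the \<open>L\<^sup>2\<close> product.\<close>

lemma vip_eq:
  assumes x: "x \<in> Vect" and y: "y \<in> Vect"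
  shows "vip \<alpha> \<beta> x y = 1 / (2 * pi) * integral {0..2 * pi}
    (\<lambda>\<theta>. (\<alpha> * (x \<theta> - eta x) - \<beta> * deriv (deriv x) \<theta> + eta x) * y \<theta>)"
proof -
  note D = Vect_DERIV[OF x] Vect_DERIV[OF y] Vect_DERIV[OF Vect_deriv[OF x]]
  note C = Vect_continuous_on integrable_continuous_real Vect_intros x y
  have "integral {0..2 * pi} (\<lambda>\<theta>. \<beta> * (deriv x \<theta> * deriv y \<theta>))
      = integral {0..2 * pi} (\<lambda>\<theta>. - \<beta> * (deriv (deriv x) \<theta> * y \<theta>))"
  proof (rule integral_cong_deriv[where F = "\<lambda>\<theta>. \<beta> * (deriv x \<theta> * y \<theta>)"], goal_cases)
    case (1 \<theta>)
    show ?case by (auto intro!: derivative_eq_intros D simp: algebra_simps)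
  next
    case 2
    show ?case by (simp add: Vect_periodic Vect_deriv x y)
  next
    case 3
    show ?case by (intro C)
  qed
  \<comment> \<open>Since \<open>x - eta x\<close> has mean zero, replacing \<open>y - eta y\<close>
    by \<open>y\<close> in the first summand of \<open>vip\<close> does not change the
    integral.\<close>
  moreover have "integral {0..2 * pi} (\<lambda>\<theta>. \<alpha> * eta y * (x \<theta> - eta x)) = 0"
    unfolding integral_mult_right
    by (subst integral_diff) (auto intro!: C simp: eta_def)
  moreover have "integral {0..2 * pi}
      (\<lambda>\<theta>. \<alpha> * (x \<theta> - eta x) * (y \<theta> - eta y) + \<beta> * deriv x \<theta> * deriv y \<theta>)
    = integral {0..2 * pi} (\<lambda>\<theta>. \<alpha> * ((x \<theta> - eta x) * y \<theta>))
      - integral {0..2 * pi} (\<lambda>\<theta>. \<alpha> * eta y * (x \<theta> - eta x))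
      + integral {0..2 * pi} (\<lambda>\<theta>. \<beta> * (deriv x \<theta> * deriv y \<theta>))"
    by (subst integral_diff[symmetric] integral_add[symmetric]; (intro C)?)+
      (simp add: algebra_simps)
  moreover have "integral {0..2 * pi}
      (\<lambda>\<theta>. (\<alpha> * (x \<theta> - eta x) - \<beta> * deriv (deriv x) \<theta> + eta x) * y \<theta>)
    = integral {0..2 * pi} (\<lambda>\<theta>. \<alpha> * ((x \<theta> - eta x) * y \<theta>))
      + integral {0..2 * pi} (\<lambda>\<theta>. - \<beta> * (deriv (deriv x) \<theta> * y \<theta>))
      + integral {0..2 * pi} (\<lambda>\<theta>. eta x * y \<theta>)"
    by (subst integral_add[symmetric]; (intro C)?)+
      (simp add: algebra_simps)
  moreover have "integral {0..2 * pi} (\<lambda>\<theta>. eta x * y \<theta>) = 2 * pi * (eta x * eta y)"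
    by (simp add: eta_def[of y])
  ultimately show ?thesis
    unfolding vip_def by (simp only:) (simp add: add_divide_distrib)
qed

text \<open>All derivatives are moved from the test field \<open>z\<close> onto \<open>u\<close>,
  turning the pairing into an L2 product with \<open>z\<close>. As \<open>u\<close> has mean zero,
  the inertia operator sends \<open>u + l1\<close> to \<open>l1 - Lop \<alpha> \<beta> u\<close>,
  whence the overall minus sign. The right-hand side is free of \<open>c\<close> because the centre
  brackets trivially.\<close>

lemma ad_top_weak:
  assumes u: "u \<in> Vect0" and z: "z \<in> Vect"
  shows "gip \<alpha> \<beta> (gadd (u, 0) ((\<lambda>\<theta>. l1), l2)) (gbracket \<mu> \<nu> (u, 0) (z, c))
    = 1 / (2 * pi) * integral {0..2 * pi} (\<lambda>\<theta>.
       (- (u \<theta> * Lop \<alpha> \<beta> (deriv u) \<theta> + 2 * deriv u \<theta> * Lop \<alpha> \<beta> u \<theta>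
         - 2 * l1 * deriv u \<theta> - l2 * Lop \<mu> \<nu> (deriv u) \<theta>)) * z \<theta>)"
proof -
  have uV: "u \<in> Vect" and eta: "eta u = 0"
    using u by (auto simp: Vect0_def)
  note D = Vect_DERIV[OF uV] Vect_DERIV[OF z] Vect_DERIV[OF Vect_deriv[OF uV]]
    Vect_DERIV[OF Vect_deriv[OF z]] Vect_DERIV[OF Vect_deriv[OF Vect_deriv[OF uV]]]
  note C = Vect_continuous_on integrable_continuous_real Vect_intros uV z
  have bracket: "vbracket u z \<in> Vect"
    unfolding vbracket_def by (intro C)
  have "vip \<alpha> \<beta> (\<lambda>\<theta>. u \<theta> + l1) (vbracket u z) = 1 / (2 * pi) * integral {0..2 * pi}
    (\<lambda>\<theta>. (\<alpha> * u \<theta> - \<beta> * deriv (deriv u) \<theta> + l1) * (deriv u \<theta> * z \<theta> - deriv z \<theta> * u \<theta>))"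
    using vip_eq[OF Vect_add[OF uV Vect_const] bracket]
    by (simp add: deriv_add_const uV eta_add_const eta vbracket_def)
  then have "gip \<alpha> \<beta> (gadd (u, 0) ((\<lambda>\<theta>. l1), l2)) (gbracket \<mu> \<nu> (u, 0) (z, c))
    = 1 / (2 * pi) * (integral {0..2 * pi}
        (\<lambda>\<theta>. (\<alpha> * u \<theta> - \<beta> * deriv (deriv u) \<theta> + l1) * (deriv u \<theta> * z \<theta> - deriv z \<theta> * u \<theta>))
      + integral {0..2 * pi}
        (\<lambda>\<theta>. l2 * (\<mu> * u \<theta> * deriv z \<theta> + \<nu> * deriv u \<theta> * deriv (deriv z) \<theta>)))"
    unfolding integral_mult_right
    by (simp add: gip_def gadd_def gbracket_def omega_def add_divide_distrib)
  also have "\<dots> = 1 / (2 * pi) * integral {0..2 * pi}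
    (\<lambda>\<theta>. (\<alpha> * u \<theta> - \<beta> * deriv (deriv u) \<theta> + l1) * (deriv u \<theta> * z \<theta> - deriv z \<theta> * u \<theta>)
      + l2 * (\<mu> * u \<theta> * deriv z \<theta> + \<nu> * deriv u \<theta> * deriv (deriv z) \<theta>))"
    by (subst integral_add) (intro C refl)+
  also have "integral {0..2 * pi}
    (\<lambda>\<theta>. (\<alpha> * u \<theta> - \<beta> * deriv (deriv u) \<theta> + l1) * (deriv u \<theta> * z \<theta> - deriv z \<theta> * u \<theta>)
      + l2 * (\<mu> * u \<theta> * deriv z \<theta> + \<nu> * deriv u \<theta> * deriv (deriv z) \<theta>))
    = integral {0..2 * pi} (\<lambda>\<theta>.
       (- (u \<theta> * Lop \<alpha> \<beta> (deriv u) \<theta> + 2 * deriv u \<theta> * Lop \<alpha> \<beta> u \<theta>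
         - 2 * l1 * deriv u \<theta> - l2 * Lop \<mu> \<nu> (deriv u) \<theta>)) * z \<theta>)"
  \<comment> \<open>\<open>F\<close> holds the boundary terms: one from the \<mu> part of the
    cocycle, two from integrating its \<nu> part by parts twice, and one from the term of the
    bracket that contains \<open>deriv z\<close>.\<close>
  proof (rule integral_cong_deriv[where F = "\<lambda>\<theta>.
      l2 * (\<mu> * u \<theta> * z \<theta> + \<nu> * (deriv u \<theta> * deriv z \<theta> - deriv (deriv u) \<theta> * z \<theta>))
      - (\<alpha> * u \<theta> - \<beta> * deriv (deriv u) \<theta> + l1) * u \<theta> * z \<theta>"], goal_cases)
    case (1 \<theta>)
    show ?case
      unfolding Lop_def by (auto intro!: derivative_eq_intros D simp: algebra_simps)
  next
    case 2
    show ?case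
      by (simp add: Vect_periodic Vect_deriv uV z)
  next
    case 3
    show ?case
      unfolding Lop_def by (intro continuous_on_mult continuous_on_minus C)
  qed
  finally show ?thesis .
qed

text \<open>A nonnegative continuous function with integral zero vanishes on one period; a shift by
  \<open>k\<close> full periods brings any angle into that period.\<close>

lemma integral_square_eq_0_imp:
  fixes f :: "real \<Rightarrow> real"
  assumes f: "f \<in> Vect" and 0: "integral {0..2 * pi} (\<lambda>\<theta>. f \<theta> * f \<theta>) = 0"
  shows "f \<theta> = 0"
proof -
  have int: "((\<lambda>\<theta>. f \<theta> * f \<theta>) has_integral 0) (cbox 0 (2 * pi))"
    using 0 integrable_integral[OF integrable_continuous_real[OF Vect_continuous_on[OF Vect_mult[OF f f]]],
      of 0 "2 * pi"] by simp
  have *: "f \<sigma> = 0" if "\<sigma> \<in> {0..2 * pi}" for \<sigma>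
    using has_integral_0_cbox_imp_0[OF Vect_continuous_on[OF Vect_mult[OF f f]] _ int, of \<sigma>] that
      pi_gt_zero by auto
  interpret periodic_fun_simple f "2 * pi"
    using f by unfold_locales (auto simp: Vect_def)
  define k where "k = \<lfloor>\<theta> / (2 * pi)\<rfloor>"
  have "f (\<theta> - of_int k * (2 * pi)) = 0"
    using floor_divide_lower[of "2 * pi" \<theta>] floor_divide_upper[of "2 * pi" \<theta>]
    by (intro *) (auto simp: k_def algebra_simps)
  then show ?thesis
    by (simp add: minus_of_int)
qed

lemma ad_top_components:
  assumes u: "u \<in> Vect0"
    and W: "is_ad_top \<mu> \<nu> \<alpha> \<beta> (u, 0) (gadd (u, 0) ((\<lambda>\<theta>. l1), l2)) W"
  shows "snd W = 0" and "eta (fst W) = 0"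
    and "Lop \<alpha> \<beta> (fst W) \<theta> =
         u \<theta> * Lop \<alpha> \<beta> (deriv u) \<theta> + 2 * deriv u \<theta> * Lop \<alpha> \<beta> u \<theta>
         - 2 * l1 * deriv u \<theta> - l2 * Lop \<mu> \<nu> (deriv u) \<theta>"
proof -
  define R where "R = (\<lambda>\<theta>. u \<theta> * Lop \<alpha> \<beta> (deriv u) \<theta> + 2 * deriv u \<theta> * Lop \<alpha> \<beta> u \<theta>
         - 2 * l1 * deriv u \<theta> - l2 * Lop \<mu> \<nu> (deriv u) \<theta>)"
  have uV: "u \<in> Vect"
    using u by (auto simp: Vect0_def)
  have wV: "fst W \<in> Vect"
    using W by (auto simp: is_ad_top_def galg_def)
  note C = Vect_continuous_on integrable_continuous_real Vect_intros uV wV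
  have RV: "R \<in> Vect"
    unfolding R_def Lop_def by (intro C)
  have weak: "vip \<alpha> \<beta> (fst W) z + snd W * c
      = 1 / (2 * pi) * integral {0..2 * pi} (\<lambda>\<theta>. - R \<theta> * z \<theta>)" if z: "z \<in> Vect" for z c
  proof -
    have "gip \<alpha> \<beta> W (z, c) =
        gip \<alpha> \<beta> (gadd (u, 0) ((\<lambda>\<theta>. l1), l2)) (gbracket \<mu> \<nu> (u, 0) (z, c))"
      using W z by (auto simp: is_ad_top_def galg_def)
    then show ?thesis
      unfolding ad_top_weak[OF u z] R_def by (simp add: gip_def)
  qed
  \<comment> \<open>Test vector \<open>(0, 1)\<close>: the right-hand side of \<open>weak\<close>
    does not involve \<open>c\<close> and vanishes for \<open>z = 0\<close>.\<close>
  show W2: "snd W = 0"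
    using weak[OF Vect_const[of 0], of 1] by (simp add: vip_def eta_def)
  note D = Vect_DERIV[OF uV] Vect_DERIV[OF Vect_deriv[OF uV]]
    Vect_DERIV[OF Vect_deriv[OF Vect_deriv[OF uV]]]
  \<comment> \<open>\<open>R\<close> is a total derivative:
    \<open>u * Lop (deriv u) + deriv u * Lop u\<close> is the derivative of
    \<open>u * Lop u\<close>, and the second copy of \<open>deriv u * Lop u\<close> integrates to
    the two quadratic terms. Against the constant field 1 the form \<open>vip\<close> reduces to the
    mean, so the mean of \<open>fst W\<close> is zero.\<close>
  have "integral {0..2 * pi} R = integral {0..2 * pi} (\<lambda>\<theta>. 0)"
  proof (rule integral_cong_deriv[where F = "\<lambda>\<theta>. u \<theta> * Lop \<alpha> \<beta> u \<theta>
      + \<beta> / 2 * (deriv u \<theta> * deriv u \<theta>) - \<alpha> / 2 * (u \<theta> * u \<theta>) - 2 * l1 * u \<theta> - l2 * Lop \<mu> \<nu> u \<theta>"],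
      goal_cases)
    case (1 \<theta>)
    show ?case
      unfolding R_def Lop_def by (auto intro!: derivative_eq_intros D simp: algebra_simps)
  next
    case 2
    show ?case
      by (simp add: Lop_def Vect_periodic Vect_deriv uV)
  qed simp
  then show eta: "eta (fst W) = 0"
    using weak[OF Vect_const[of 1], of 0] by (simp add: vip_def eta_def[of "\<lambda>_. 1"])
  have LV: "(\<lambda>\<theta>. - Lop \<alpha> \<beta> (fst W) \<theta>) \<in> Vect"
    unfolding Lop_def minus_diff_eq by (intro C)
  have nRV: "(\<lambda>\<theta>. - R \<theta>) \<in> Vect"
    using Vect_mult[OF Vect_const[of "- 1"] RV] by simp
  \<comment> \<open>\<open>f\<close> is the defect of the claimed equation. With the mean of
    \<open>fst W\<close> known to be zero, the inertia operator acts on it as \<open>- Lop\<close>,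
    so testing \<open>weak\<close> against \<open>f\<close> itself makes the integral of its square
    vanish.\<close>
  define f where "f = (\<lambda>\<theta>. - R \<theta> - (- Lop \<alpha> \<beta> (fst W) \<theta>))"
  have fV: "f \<in> Vect"
    unfolding f_def by (intro Vect_diff nRV LV)
  have square: "(\<lambda>\<theta>. f \<theta> * f \<theta>)
      = (\<lambda>\<theta>. - R \<theta> * f \<theta> - - Lop \<alpha> \<beta> (fst W) \<theta> * f \<theta>)"
    unfolding f_def by (rule ext) (rule left_diff_distrib)
  have "integral {0..2 * pi} (\<lambda>\<theta>. f \<theta> * f \<theta>)
      = integral {0..2 * pi} (\<lambda>\<theta>. - R \<theta> * f \<theta>)
        - integral {0..2 * pi} (\<lambda>\<theta>. - Lop \<alpha> \<beta> (fst W) \<theta> * f \<theta>)"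
    unfolding square
    by (rule integral_diff)
      (intro integrable_continuous_real Vect_continuous_on Vect_mult LV nRV fV)+
  moreover have "1 / (2 * pi) * integral {0..2 * pi} (\<lambda>\<theta>. - Lop \<alpha> \<beta> (fst W) \<theta> * f \<theta>)
      = 1 / (2 * pi) * integral {0..2 * pi} (\<lambda>\<theta>. - R \<theta> * f \<theta>)"
    using weak[OF fV, of 0] unfolding vip_eq[OF wV fV] eta by (simp add: Lop_def)
  then have "integral {0..2 * pi} (\<lambda>\<theta>. - R \<theta> * f \<theta>)
      - integral {0..2 * pi} (\<lambda>\<theta>. - Lop \<alpha> \<beta> (fst W) \<theta> * f \<theta>) = 0"
    unfolding mult_cancel_left by simp
  ultimately have "integral {0..2 * pi} (\<lambda>\<theta>. f \<theta> * f \<theta>) = 0"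
    by (rule trans)
  with fV have "f \<theta> = 0"
    by (rule integral_square_eq_0_imp)
  then show "Lop \<alpha> \<beta> (fst W) \<theta> =
         u \<theta> * Lop \<alpha> \<beta> (deriv u) \<theta> + 2 * deriv u \<theta> * Lop \<alpha> \<beta> u \<theta>
         - 2 * l1 * deriv u \<theta> - l2 * Lop \<mu> \<nu> (deriv u) \<theta>"
    by (simp add: f_def R_def)
qed

section \<open>Normal geodesics\<close>

lemma smooth_curve_differentiable:
  assumes "smooth_curve c" and t: "t \<in> {0..1}"
  shows "(\<lambda>s. fst (c s) \<theta>) differentiable (at t within {0..1})"
    and "(\<lambda>s. snd (c s)) differentiable (at t within {0..1})"
proof -
  from assms(1) have "times_diff_on (Suc 0) ({0..1} \<times> UNIV) (\<lambda>(t, \<theta>). fst (c t) \<theta>)"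
    and "times_diff_on (Suc 0) {0..1} (\<lambda>t. snd (c t))"
    unfolding smooth_curve_def smooth_on_def by blast+
  then have 1: "(\<lambda>(t, \<theta>). fst (c t) \<theta>) differentiable (at (t, \<theta>) within {0..1} \<times> UNIV)"
    and 2: "(\<lambda>s. snd (c s)) differentiable (at t within {0..1})"
    using t unfolding times_diff_on.simps(2) by auto
  show "(\<lambda>s. snd (c s)) differentiable (at t within {0..1})" by (rule 2)
  \<comment> \<open>Joint smoothness is restricted to the time direction by composing with the
    embedding of \<open>[0,1]\<close> at a fixed angle.\<close>
  have "(\<lambda>(t, \<theta>). fst (c t) \<theta>) \<circ> (\<lambda>s. (s, \<theta>)) differentiable (at t within {0..1})"
    by (intro differentiable_chain_within differentiable_within_subset[OF 1])
      (auto intro!: derivative_intros simp: differentiable_def intro: has_derivative_Pair)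
  then show "(\<lambda>s. fst (c s) \<theta>) differentiable (at t within {0..1})"
    by (simp add: o_def)
qed

lemma constant_of_vector_derivative_zero:
  fixes f :: "real \<Rightarrow> real"
  assumes "\<And>t. t \<in> {0..1} \<Longrightarrow> f differentiable (at t within {0..1})"
    and "\<And>t. t \<in> {0..1} \<Longrightarrow> vector_derivative f (at t within {0..1}) = 0"
    and "t \<in> {0..1}"
  shows "f t = f 0"
proof (rule has_derivative_zero_unique[of "{0..1}" f])
  show "(f has_derivative (\<lambda>h. 0)) (at t within {0..1})" if "t \<in> {0..1}" for t
    using assms(1,2)[OF that] by (simp add: vector_derivative_works has_vector_derivative_def)
qed (use assms(3) in auto)

theorem mainTheorem6:
  fixes \<mu> \<nu> \<alpha> \<beta> :: real
    and \<gamma> :: "real \<Rightarrow> real \<Rightarrow> real" and b :: "real \<Rightarrow> real"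
  assumes "\<beta> \<ge> 0" and "\<alpha> > - \<beta>"
    and "normal_geodesic \<mu> \<nu> \<alpha> \<beta> (\<lambda>t. (\<gamma> t, b t))"
  shows "\<exists>u :: real \<Rightarrow> real \<Rightarrow> real.
    (\<forall>t\<in>{0..1}. left_log_deriv \<mu> \<nu> (\<lambda>t. (\<gamma> t, b t)) t = (u t, 0) \<and> u t \<in> Vect0) \<and>
    (\<exists>l1 l2 :: real. \<forall>t\<in>{0..1}. \<forall>\<theta>.
       Lop \<alpha> \<beta> (tdot u t) \<theta> =
         u t \<theta> * Lop \<alpha> \<beta> (deriv (u t)) \<theta> + 2 * deriv (u t) \<theta> * Lop \<alpha> \<beta> (u t) \<theta>
         - 2 * l1 * deriv (u t) \<theta> - l2 * Lop \<mu> \<nu> (deriv (u t)) \<theta>)"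
proof -
  define c where "c = (\<lambda>t. (\<gamma> t, b t))"
  define U where "U = left_log_deriv \<mu> \<nu> c"
  define u where "u = (\<lambda>t. fst (U t))"
  have hor: "horizontal \<mu> \<nu> c"
    using assms(3) by (simp add: normal_geodesic_def critical_def c_def)
  have U: "U t = (u t, 0) \<and> u t \<in> Vect0" if t: "t \<in> {0..1}" for t
  proof -
    have "cdot c t \<in> Ebundle \<mu> \<nu> (c t)"
      using hor t by (simp add: horizontal_def)
    then obtain x where x: "x \<in> Vect0" "cdot c t = dleft \<mu> \<nu> (c t) gone (x, 0)"
      by (auto simp: Ebundle_def)
    then have "U t = (x, 0)"
      using hor t dleft_ginv_dleft[of "c t" x \<mu> \<nu>]
      by (auto simp: U_def left_log_deriv_def horizontal_def Vect0_def)
    with x show ?thesis by (simp add: u_def)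
  qed
  obtain \<Lambda> where \<Lambda>: "smooth_curve \<Lambda>" "\<And>t. t \<in> {0..1} \<Longrightarrow> \<Lambda> t \<in> kalg"
    and "\<forall>t\<in>{0..1}. \<exists>W. is_ad_top \<mu> \<nu> \<alpha> \<beta> (U t) (gadd (U t) (\<Lambda> t)) W \<and>
           cdot U t = pr_Vect0 W \<and> cdot \<Lambda> t = pr_kalg W"
    using assms(3) unfolding normal_geodesic_def U_def c_def by blast
  then obtain W where W: "\<And>t. t \<in> {0..1} \<Longrightarrow> is_ad_top \<mu> \<nu> \<alpha> \<beta> (U t) (gadd (U t) (\<Lambda> t)) (W t)"
      "\<And>t. t \<in> {0..1} \<Longrightarrow> cdot U t = pr_Vect0 (W t)"
      "\<And>t. t \<in> {0..1} \<Longrightarrow> cdot \<Lambda> t = pr_kalg (W t)"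
    by metis
  \<comment> \<open>The multipliers are the initial values of \<Lambda>. In \<open>l1\<close> the
    inner 0 is the initial time and the outer 0 an arbitrary angle, as elements of
    \<open>kalg\<close> have constant first component.\<close>
  define l1 where "l1 = fst (\<Lambda> 0) 0"
  define l2 where "l2 = snd (\<Lambda> 0)"
  have \<Lambda>_eq: "\<Lambda> t = ((\<lambda>\<theta>. fst (\<Lambda> t) 0), snd (\<Lambda> t))" if "t \<in> {0..1}" for t
    using \<Lambda>(2)[OF that] by (auto simp: kalg_def)
  have top: "is_ad_top \<mu> \<nu> \<alpha> \<beta> (u t, 0) (gadd (u t, 0) ((\<lambda>\<theta>. fst (\<Lambda> t) 0), snd (\<Lambda> t))) (W t)"
    if "t \<in> {0..1}" for t
    using W(1)[OF that] U[OF that] \<Lambda>_eq[OF that] by simp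
  \<comment> \<open>\<open>pr_kalg\<close> records the mean and the central component of
    \<open>W t\<close>, and both are zero.\<close>
  have "cdot \<Lambda> t = ((\<lambda>\<theta>. 0), 0)" if t: "t \<in> {0..1}" for t
    using W(3)[OF t] ad_top_components(1,2)[OF _ top[OF t]] U[OF t] by (simp add: pr_kalg_def)
  then have \<Lambda>': "vector_derivative (\<lambda>s. fst (\<Lambda> s) 0) (at t within {0..1}) = 0"
      "vector_derivative (\<lambda>s. snd (\<Lambda> s)) (at t within {0..1}) = 0" if "t \<in> {0..1}" for t
    using that by (auto simp: cdot_def tdot_def fun_eq_iff)
  have l: "fst (\<Lambda> t) 0 = l1" "snd (\<Lambda> t) = l2" if "t \<in> {0..1}" for t
    unfolding l1_def l2_def
    by (rule constant_of_vector_derivative_zero[OF smooth_curve_differentiable(1)[OF \<Lambda>(1)] \<Lambda>'(1) that]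
        constant_of_vector_derivative_zero[OF smooth_curve_differentiable(2)[OF \<Lambda>(1)] \<Lambda>'(2) that];
        assumption)+
  have "Lop \<alpha> \<beta> (tdot u t) \<theta> =
         u t \<theta> * Lop \<alpha> \<beta> (deriv (u t)) \<theta> + 2 * deriv (u t) \<theta> * Lop \<alpha> \<beta> (u t) \<theta>
         - 2 * l1 * deriv (u t) \<theta> - l2 * Lop \<mu> \<nu> (deriv (u t)) \<theta>" if t: "t \<in> {0..1}" for t \<theta>
  proof -
    note * = ad_top_components(2,3)[OF conjunct2[OF U[OF t]] top[OF t, unfolded l[OF t]]]
    \<comment> \<open>\<open>pr_Vect0\<close> subtracts the mean of \<open>fst (W t)\<close>, which
      is zero, so the velocity of \<open>u\<close> is all of \<open>fst (W t)\<close> and inherits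
      its equation.\<close>
    have "tdot u t = fst (W t)"
      using W(2)[OF t] *(1) by (simp add: cdot_def pr_Vect0_def u_def)
    with *(2) show ?thesis by simp
  qed
  with U show ?thesis
    unfolding c_def[symmetric] U_def[symmetric] by blast
qed

end
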